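(* For any graph class $\mathcal{F}$ and every positive integer $n$ we have $$M_{\mathcal{F}}(n)\cdot D_{\mathcal{F}}(n)\le 2^{\binom{n}{2}}.$$
   Context: All graphs are finite and simple. For two graphs $G,G'$ on the vertex set $[n]=\{1,\dots,n\}$, $G\oplus G'$ denotes the graph on $[n]$ whose edge set is the symmetric difference of $E(G)$ and $E(G')$. For a class $\mathcal{F}$ of graphs, $M_{\mathcal{F}}(n)$ denotes the maximum possible size of a family of (labeled) graphs on vertex set $[n]$ such that $G\oplus G'\in\mathcal{F}$ for any two distinct members $G,G'$ of the family, and $D_{\mathcal{F}}(n)$ denotes the maximum possible size of a family of (labeled) graphs on vertex set $[n]$ such that $G\oplus G'\notin\mathcal{F}$ for any two distinct members $G,G'$ of the family. *)

theory Defs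
  imports Complex_Main
begin

record 'a sgraph =
  verts :: "'a set"
  edges :: "'a set set"

definition simple_graph :: "'a sgraph \<Rightarrow> bool" where
  "simple_graph G \<longleftrightarrow> finite (verts G) \<and> edges G \<subseteq> {e. e \<subseteq> verts G \<and> card e = 2}"

(* Closure under isomorphism is not required. *)
definition graph_class :: "'a sgraph set \<Rightarrow> bool" where
  "graph_class F \<longleftrightarrow> (\<forall>G\<in>F. simple_graph G)"

definition graphs_on :: "nat \<Rightarrow> nat sgraph set" where
  "graphs_on n = {G. simple_graph G \<and> verts G = {1..n}}"

(* Only applied to two graphs on the same vertex set, where the union of vertex sets
   is that common set. *)
definition graph_sum :: "'a sgraph \<Rightarrow> 'a sgraph \<Rightarrow> 'a sgraph" (infixl \<open>\<oplus>\<close> 65) where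
  "G \<oplus> H = \<lparr>verts = verts G \<union> verts H,
              edges = (edges G - edges H) \<union> (edges H - edges G)\<rparr>"

definition M_num :: "nat sgraph set \<Rightarrow> nat \<Rightarrow> nat" where
  "M_num F n = Max {card A | A. A \<subseteq> graphs_on n \<and> pairwise (\<lambda>G H. G \<oplus> H \<in> F) A}"

definition D_num :: "nat sgraph set \<Rightarrow> nat \<Rightarrow> nat" where
  "D_num F n = Max {card A | A. A \<subseteq> graphs_on n \<and> pairwise (\<lambda>G H. G \<oplus> H \<notin> F) A}"

(* The following facts ensure that both maxima are taken over finite nonempty sets. *)

lemma finite_graphs_on: "finite (graphs_on n)"
proof (rule inj_on_finite)
  show "inj_on edges (graphs_on n)"
    by (auto simp: inj_on_def graphs_on_def intro: sgraph.equality)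
  show "edges ` graphs_on n \<subseteq> Pow (Pow {1..n})"
    unfolding graphs_on_def simple_graph_def by blast
qed simp

lemma finite_family_sizes: "finite {card A | A. A \<subseteq> graphs_on n \<and> P A}"
  by (rule finite_subset[of _ "card ` Pow (graphs_on n)"]) (auto simp: finite_graphs_on)

lemma family_sizes_nonempty: "{card A | A. A \<subseteq> graphs_on n \<and> pairwise R A} \<noteq> {}"
  using pairwise_empty by blast

end

theory Submission
  imports Defs
begin

text \<open>
  The graphs on \<open>[n]\<close> form a group of exponent two under \<open>\<oplus>\<close>, of order \<open>2 ^ (n choose 2)\<close>.
  Take a family \<open>A\<close> whose pairwise sums all lie in \<open>F\<close> and a family \<open>B\<close> whose pairwise sums
  all avoid \<open>F\<close>. In such a group \<open>G \<oplus> H = G' \<oplus> H'\<close> is the same as \<open>G \<oplus> G' = H \<oplus> H'\<close>, so two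
  different pairs in \<open>A \<times> B\<close> with the same sum would produce one graph that is both inside and
  outside \<open>F\<close>. Hence \<open>\<oplus>\<close> is injective on \<open>A \<times> B\<close> (lemma \<open>inj_on_graph_sum\<close>), and
  \<open>A \<times> B\<close> has at most as many elements as there are graphs on \<open>[n]\<close>.
\<close>

lemma card_graphs_on: "card (graphs_on n) = 2 ^ (n choose 2)"
proof -
  let ?E = "{e. e \<subseteq> {1..n} \<and> card e = 2}"
  have "bij_betw edges (graphs_on n) (Pow ?E)"
  proof (rule bij_betwI')
    show "(edges G = edges H) = (G = H)" if "G \<in> graphs_on n" "H \<in> graphs_on n" for G H
      using that by (auto simp: graphs_on_def intro: sgraph.equality)
    show "edges G \<in> Pow ?E" if "G \<in> graphs_on n" for G
      using that by (auto simp: graphs_on_def simple_graph_def)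
    show "\<exists>G\<in>graphs_on n. X = edges G" if "X \<in> Pow ?E" for X
      using that
      by (intro bexI[of _ "\<lparr>verts = {1..n}, edges = X\<rparr>"])
         (auto simp: graphs_on_def simple_graph_def)
  qed
  then have "card (graphs_on n) = card (Pow ?E)"
    by (rule bij_betw_same_card)
  also have "\<dots> = 2 ^ (n choose 2)"
    using n_subsets[of "{1..n}" 2] by (simp add: card_Pow)
  finally show ?thesis .
qed

lemma graph_sum_in_graphs_on:
  assumes "G \<in> graphs_on n" "H \<in> graphs_on n"
  shows "G \<oplus> H \<in> graphs_on n"
  using assms unfolding graphs_on_def simple_graph_def graph_sum_def by simp blast

lemma edges_graph_sum_iff: "e \<in> edges (G \<oplus> H) \<longleftrightarrow> (e \<in> edges G) \<noteq> (e \<in> edges H)"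
  by (auto simp: graph_sum_def)

lemma graph_sum_left_cancel:
  assumes "verts H = verts H'" "G \<oplus> H = G \<oplus> H'"
  shows "H = H'"
proof -
  have "e \<in> edges H \<longleftrightarrow> e \<in> edges H'" for e
    using edges_graph_sum_iff[of e G H] edges_graph_sum_iff[of e G H'] assms(2) by metis
  then have "edges H = edges H'" by blast
  with assms(1) show ?thesis by simp
qed

lemma graph_sum_commute: "G \<oplus> H = H \<oplus> G"
  by (simp add: graph_sum_def Un_commute)

lemma graph_sum_exchange:
  assumes "verts G = V" "verts G' = V" "verts H = V" "verts H' = V"
    and "G \<oplus> H = G' \<oplus> H'"
  shows "G \<oplus> G' = H \<oplus> H'"
proof -
  have "e \<in> edges (G \<oplus> G') \<longleftrightarrow> e \<in> edges (H \<oplus> H')" for e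
    using edges_graph_sum_iff[of e G H] edges_graph_sum_iff[of e G' H'] assms(5)
      edges_graph_sum_iff[of e G G'] edges_graph_sum_iff[of e H H'] by metis
  then have "edges (G \<oplus> G') = edges (H \<oplus> H')" by blast
  moreover have "verts (G \<oplus> G') = verts (H \<oplus> H')"
    using assms(1-4) by (simp add: graph_sum_def)
  ultimately show ?thesis by simp
qed

text \<open>
  The exchange law turns a coincidence of sums across the two families into a coincidence
  between a sum within \<open>A\<close> and a sum within \<open>B\<close>. Cancellation supplies what the two pairwise
  conditions presuppose: two different pairs with the same sum differ in both coordinates.
\<close>

lemma inj_on_graph_sum:
  assumes A: "A \<subseteq> graphs_on n" "pairwise (\<lambda>G H. G \<oplus> H \<in> F) A"
    and B: "B \<subseteq> graphs_on n" "pairwise (\<lambda>G H. G \<oplus> H \<notin> F) B"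
  shows "inj_on (\<lambda>(G, H). G \<oplus> H) (A \<times> B)"
proof -
  have "G = G' \<and> H = H'"
    if in_fam: "G \<in> A" "G' \<in> A" "H \<in> B" "H' \<in> B" and eq: "G \<oplus> H = G' \<oplus> H'" for G G' H H'
  proof -
    have v: "verts G = {1..n}" "verts G' = {1..n}" "verts H = {1..n}" "verts H' = {1..n}"
      using in_fam A(1) B(1) by (auto simp: graphs_on_def)
    have ex: "G \<oplus> G' = H \<oplus> H'"
      using graph_sum_exchange[OF v eq] .
    have iff: "G = G' \<longleftrightarrow> H = H'"
      using graph_sum_left_cancel[of H H' G] graph_sum_left_cancel[of G G' H] v eq
      by (metis graph_sum_commute)
    show ?thesis
    proof (rule ccontr)
      assume "\<not> ?thesis"
      with iff have "G \<noteq> G'" "H \<noteq> H'" by auto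
      then have "G \<oplus> G' \<in> F" "H \<oplus> H' \<notin> F"
        using pairwiseD[OF A(2)] pairwiseD[OF B(2)] in_fam by auto
      with ex show False by simp
    qed
  qed
  then show ?thesis by (auto simp: inj_on_def)
qed

lemma card_family_product_le:
  assumes "A \<subseteq> graphs_on n" "pairwise (\<lambda>G H. G \<oplus> H \<in> F) A"
    and "B \<subseteq> graphs_on n" "pairwise (\<lambda>G H. G \<oplus> H \<notin> F) B"
  shows "card A * card B \<le> 2 ^ (n choose 2)"
proof -
  have "card (A \<times> B) \<le> card (graphs_on n)"
    using assms(1,3)
    by (intro card_inj_on_le[OF inj_on_graph_sum[OF assms]] finite_graphs_on)
       (auto intro: graph_sum_in_graphs_on)
  then show ?thesis
    by (simp add: card_graphs_on card_cartesian_product)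
qed

theorem lemma1:
  fixes F :: "nat sgraph set" and n :: nat
  assumes "graph_class F" and "n > 0"
  shows "M_num F n * D_num F n \<le> 2 ^ (n choose 2)"
proof -
  obtain A where "M_num F n = card A" "A \<subseteq> graphs_on n" "pairwise (\<lambda>G H. G \<oplus> H \<in> F) A"
    using Max_in[OF finite_family_sizes family_sizes_nonempty, of n "\<lambda>G H. G \<oplus> H \<in> F"]
    unfolding M_num_def by blast
  moreover
  obtain B where "D_num F n = card B" "B \<subseteq> graphs_on n" "pairwise (\<lambda>G H. G \<oplus> H \<notin> F) B"
    using Max_in[OF finite_family_sizes family_sizes_nonempty, of n "\<lambda>G H. G \<oplus> H \<notin> F"]
    unfolding D_num_def by blast
  ultimately show ?thesis
    using card_family_product_le by metis
qed

end
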